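(* For every $n\ge1$ and $\epsilon\in\{\pm1\}^n$, the abelian metric Lie groups $\mathbf{L}_n$, $LPM_n(\epsilon)$ and $TPM_n(\epsilon)$ (with the group operations and Riemannian distances in the context) are isometrically isomorphic to the Euclidean space $\mathbb{R}^{n(n+1)/2}$ (with addition and the Euclidean distance): there is a bijection that is simultaneously a group isomorphism and an isometry. Hence they are separable and complete.
   Context: $LPM_n(\epsilon)$ (resp. $TPM_n(\epsilon)$) is the set of real symmetric $n\times n$ matrices whose leading (resp. trailing) principal $k\times k$ minor is nonzero of sign $\epsilon_k$, $1\le k\le n$. $\mathbf{L}_n$ is the set of real lower triangular $n\times n$ matrices with positive diagonal. $\mathbb{D}_\epsilon=\mathrm{diag}(\epsilon_1,\epsilon_1\epsilon_2,\dots,\epsilon_{n-1}\epsilon_n)$ and $P_n$ is the anti-diagonal permutation matrix. $\lfloor L\rfloor$ and $\mathbb{D}(L)$ denote the strictly lower triangular and diagonal parts of $L$. On $\mathbf{L}_n$: group operation $L\circledcirc K=\lfloor L\rfloor+\lfloor K\rfloor+\mathbb{D}(L)\mathbb{D}(K)$; Riemannian metric $\widetilde g_L(X,Y)=\sum_{i>j}x_{ij}y_{ij}+\sum_jx_{jj}y_{jj}l_{jj}^{-2}$ with distance $d_{\mathbf{L}_n}(L,K)=\big(\sum_{i>j}(l_{ij}-k_{ij})^2+\sum_j(\log l_{jj}-\log k_{jj})^2\big)^{1/2}$. The structures on $LPM_n(\epsilon)$ and $TPM_n(\epsilon)$ are the transports of these along the smooth diffeomorphisms $\mathbf{L}_n\to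 LPM_n(\epsilon)$, $L\mapsto L\mathbb{D}_\epsilon L^T$, and $\mathbf{L}_n\to TPM_n(\epsilon)$, $L\mapsto L^T(P_n\mathbb{D}_\epsilon P_n)L$. *)

theory Defs
  imports
    "HOL-Analysis.Analysis"
    "Jordan_Normal_Form.Determinant"
    "Jordan_Normal_Form.DL_Submatrix"
begin

text \<open>Matrix entries are indexed from 0, whereas the sign vector \<open>\<epsilon>\<close> is indexed by the order
  \<open>1, \<dots>, n\<close> of the minors.\<close>

definition sign_vector :: "nat \<Rightarrow> (nat \<Rightarrow> real) \<Rightarrow> bool" where
  "sign_vector n \<epsilon> \<longleftrightarrow> (\<forall>k\<in>{1..n}. \<epsilon> k \<in> {1, -1})"

definition leading_minor :: "nat \<Rightarrow> real mat \<Rightarrow> real" where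
  "leading_minor k A = det (submatrix A {0..<k} {0..<k})"

definition trailing_minor :: "nat \<Rightarrow> nat \<Rightarrow> real mat \<Rightarrow> real" where
  "trailing_minor n k A = det (submatrix A {n - k..<n} {n - k..<n})"

definition LPM :: "nat \<Rightarrow> (nat \<Rightarrow> real) \<Rightarrow> real mat set" where
  "LPM n \<epsilon> = {A \<in> carrier_mat n n. transpose_mat A = A \<and>
     (\<forall>k\<in>{1..n}. leading_minor k A \<noteq> 0 \<and> sgn (leading_minor k A) = \<epsilon> k)}"

definition TPM :: "nat \<Rightarrow> (nat \<Rightarrow> real) \<Rightarrow> real mat set" where
  "TPM n \<epsilon> = {A \<in> carrier_mat n n. transpose_mat A = A \<and>
     (\<forall>k\<in>{1..n}. trailing_minor n k A \<noteq> 0 \<and> sgn (trailing_minor n k A) = \<epsilon> k)}"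

definition pos_lower :: "nat \<Rightarrow> real mat set" where
  "pos_lower n = {L \<in> carrier_mat n n.
     (\<forall>i<n. \<forall>j<n. i < j \<longrightarrow> L $$ (i, j) = 0) \<and> (\<forall>j<n. L $$ (j, j) > 0)}"

definition sign_diag :: "nat \<Rightarrow> (nat \<Rightarrow> real) \<Rightarrow> real mat" where
  "sign_diag n \<epsilon> = mat_diag n (\<lambda>i. if i = 0 then \<epsilon> 1 else \<epsilon> i * \<epsilon> (i + 1))"

definition antidiag_perm :: "nat \<Rightarrow> real mat" where
  "antidiag_perm n = Matrix.mat n n (\<lambda>(i, j). if i + j + 1 = n then 1 else 0)"

definition strict_lower_part :: "nat \<Rightarrow> real mat \<Rightarrow> real mat" where
  "strict_lower_part n L = Matrix.mat n n (\<lambda>(i, j). if j < i then L $$ (i, j) else 0)"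

definition diag_part :: "nat \<Rightarrow> real mat \<Rightarrow> real mat" where
  "diag_part n L = mat_diag n (\<lambda>j. L $$ (j, j))"


definition L_group :: "nat \<Rightarrow> real mat monoid" where
  "L_group n = \<lparr>carrier = pos_lower n,
     mult = (\<lambda>L K. strict_lower_part n L + strict_lower_part n K + diag_part n L * diag_part n K),
     one = 1\<^sub>m n\<rparr>"

definition L_metric :: "nat \<Rightarrow> real mat \<Rightarrow> real mat \<Rightarrow> real mat \<Rightarrow> real" where
  "L_metric n L X Y = (\<Sum>i<n. \<Sum>j<i. X $$ (i, j) * Y $$ (i, j)) +
     (\<Sum>j<n. X $$ (j, j) * Y $$ (j, j) / (L $$ (j, j))\<^sup>2)"

definition L_dist :: "nat \<Rightarrow> real mat \<Rightarrow> real mat \<Rightarrow> real" where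
  "L_dist n L K = sqrt ((\<Sum>i<n. \<Sum>j<i. (L $$ (i, j) - K $$ (i, j))\<^sup>2) +
     (\<Sum>j<n. (ln (L $$ (j, j)) - ln (K $$ (j, j)))\<^sup>2))"


text \<open>\<open>L_dist\<close> is the Riemannian distance of \<open>L_metric\<close>: the infimum (here a minimum) of the
  lengths of curves. A curve is given together with its velocity; continuity of the velocity up to
  the end points makes the length integrand continuous, so that no length integral is undefined.\<close>

definition L_curve :: "nat \<Rightarrow> real mat \<Rightarrow> real mat \<Rightarrow> (real \<Rightarrow> real mat) \<Rightarrow> (real \<Rightarrow> real mat) \<Rightarrow> bool"
  where
  "L_curve n L K \<gamma> \<gamma>' \<longleftrightarrow> \<gamma> 0 = L \<and> \<gamma> 1 = K \<and> (\<forall>t\<in>{0..1}. \<gamma> t \<in> pos_lower n) \<and>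
     (\<forall>i<n. \<forall>j<n.
        (\<forall>t\<in>{0..1}. ((\<lambda>s. \<gamma> s $$ (i, j)) has_real_derivative \<gamma>' t $$ (i, j)) (at t within {0..1})) \<and>
        continuous_on {0..1} (\<lambda>t. \<gamma>' t $$ (i, j)))"

definition L_length :: "nat \<Rightarrow> (real \<Rightarrow> real mat) \<Rightarrow> (real \<Rightarrow> real mat) \<Rightarrow> real" where
  "L_length n \<gamma> \<gamma>' = integral {0..1} (\<lambda>t. sqrt (L_metric n (\<gamma> t) (\<gamma>' t) (\<gamma>' t)))"

lemma L2_set_le_length:
  fixes c c' :: "'p \<Rightarrow> real \<Rightarrow> real"
  assumes "finite I"
    and der: "\<And>p t. p \<in> I \<Longrightarrow> t \<in> {0..1} \<Longrightarrow> (c p has_real_derivative c' p t) (at t within {0..1})"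
    and cont: "\<And>p. p \<in> I \<Longrightarrow> continuous_on {0..1} (c' p)"
  shows "L2_set (\<lambda>p. c p 1 - c p 0) I \<le> integral {0..1} (\<lambda>t. L2_set (\<lambda>p. c' p t) I)"
proof -
  let ?v = "\<lambda>p. c p 1 - c p 0"
  let ?N = "L2_set ?v I"
  have contS: "continuous_on {0..1} (\<lambda>t. L2_set (\<lambda>p. c' p t) I)"
    unfolding L2_set_def by (intro continuous_intros cont)
  then have intS: "(\<lambda>t. L2_set (\<lambda>p. c' p t) I) integrable_on {0..1}"
    by (rule integrable_continuous_real)
  have ftc: "(c' p has_integral ?v p) {0..1}" if "p \<in> I" for p
    by (rule fundamental_theorem_of_calculus)
      (use der[OF that] in \<open>auto simp: has_real_derivative_iff_has_vector_derivative\<close>)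
  have sumI: "((\<lambda>t. \<Sum>p\<in>I. ?v p * c' p t) has_integral (\<Sum>p\<in>I. ?v p * ?v p)) {0..1}"
    by (intro has_integral_sum \<open>finite I\<close> has_integral_mult_right ftc)
  have N2: "(\<Sum>p\<in>I. ?v p * ?v p) = ?N * ?N"
    by (simp add: L2_set_def power2_eq_square[symmetric] sum_nonneg)
  have bound: "((\<lambda>t. ?N * L2_set (\<lambda>p. c' p t) I) has_integral
      ?N * integral {0..1} (\<lambda>t. L2_set (\<lambda>p. c' p t) I)) {0..1}"
    by (intro has_integral_mult_right integrable_integral intS)
  have "?N * ?N \<le> ?N * integral {0..1} (\<lambda>t. L2_set (\<lambda>p. c' p t) I)"
  proof (rule has_integral_le[OF sumI[unfolded N2] bound])
    fix t :: real
    have "(\<Sum>p\<in>I. ?v p * c' p t) \<le> (\<Sum>p\<in>I. \<bar>?v p\<bar> * \<bar>c' p t\<bar>)"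
      by (intro sum_mono) (metis abs_ge_self abs_mult)
    also have "\<dots> \<le> ?N * L2_set (\<lambda>p. c' p t) I"
      by (rule L2_set_mult_ineq)
    finally show "(\<Sum>p\<in>I. ?v p * c' p t) \<le> ?N * L2_set (\<lambda>p. c' p t) I" .
  qed
  moreover have "0 \<le> integral {0..1} (\<lambda>t. L2_set (\<lambda>p. c' p t) I)"
    by (intro integral_nonneg intS) simp
  moreover have "0 \<le> ?N" by simp
  ultimately show ?thesis
    by (cases "?N = 0") (auto simp: mult_le_cancel_left_pos)
qed

lemma sum_lower_triangle:
  fixes f :: "nat \<times> nat \<Rightarrow> real"
  shows "(\<Sum>p\<in>(SIGMA i:{..<n}. {..i}). f p) = (\<Sum>i<n. \<Sum>j<i. f (i, j)) + (\<Sum>j<n. f (j, j))"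
proof -
  have "(\<Sum>p\<in>(SIGMA i:{..<n}. {..i}). f p) = (\<Sum>i<n. \<Sum>j\<le>i. f (i, j))"
    by (simp add: sum.Sigma)
  also have "\<dots> = (\<Sum>i<n. (\<Sum>j<i. f (i, j)) + f (i, i))"
    by (simp add: lessThan_Suc_atMost[symmetric])
  finally show ?thesis by (simp add: sum.distrib)
qed

lemma L_dist_le_length:
  assumes "L_curve n L K \<gamma> \<gamma>'"
  shows "L_dist n L K \<le> L_length n \<gamma> \<gamma>'"
proof -
  let ?I = "SIGMA i:{..<n}. {..i}"
  define c where "c p t = (if fst p = snd p then ln (\<gamma> t $$ p) else \<gamma> t $$ p)" for p t
  define c' where "c' p t = (if fst p = snd p then \<gamma>' t $$ p / \<gamma> t $$ p else \<gamma>' t $$ p)" for p t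
  have ends: "\<gamma> 0 = L" "\<gamma> 1 = K"
    and pos: "\<And>t j. t \<in> {0..1} \<Longrightarrow> j < n \<Longrightarrow> \<gamma> t $$ (j, j) > 0"
    and der: "\<And>t i j. t \<in> {0..1} \<Longrightarrow> i < n \<Longrightarrow> j < n \<Longrightarrow>
      ((\<lambda>s. \<gamma> s $$ (i, j)) has_real_derivative \<gamma>' t $$ (i, j)) (at t within {0..1})"
    and cont: "\<And>i j. i < n \<Longrightarrow> j < n \<Longrightarrow> continuous_on {0..1} (\<lambda>t. \<gamma>' t $$ (i, j))"
    using assms by (auto simp: L_curve_def pos_lower_def)
  have contg: "continuous_on {0..1} (\<lambda>t. \<gamma> t $$ (i, j))" if "i < n" "j < n" for i j
    by (rule DERIV_continuous_on[where D = "\<lambda>t. \<gamma>' t $$ (i, j)"]) (rule der[OF _ that])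
  have "L2_set (\<lambda>p. c p 1 - c p 0) ?I \<le> integral {0..1} (\<lambda>t. L2_set (\<lambda>p. c' p t) ?I)"
  proof (rule L2_set_le_length)
    fix p and t :: real assume p: "p \<in> ?I" and t: "t \<in> {0..1}"
    obtain i j where ij: "p = (i, j)" "i < n" "j < n" using p by auto
    show "(c p has_real_derivative c' p t) (at t within {0..1})"
    proof (cases "i = j")
      case True
      show ?thesis
        using DERIV_ln_divide[OF pos[OF t ij(3)]] der[OF t ij(2,3)] True ij
        by (auto simp: c_def[abs_def] c'_def intro!: derivative_eq_intros pos[OF t])
    next
      case False
      then show ?thesis using der[OF t ij(2,3)] ij by (simp add: c_def[abs_def] c'_def)
    qed
  next
    fix p assume p: "p \<in> ?I"
    obtain i j where ij: "p = (i, j)" "i < n" "j < n" using p by auto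
    show "continuous_on {0..1} (c' p)"
    proof (cases "i = j")
      case True
      have "continuous_on {0..1} (\<lambda>t. \<gamma>' t $$ (j, j) / \<gamma> t $$ (j, j))"
        by (intro continuous_intros cont contg ij) (use pos ij in force)
      then show ?thesis using True ij by (simp add: c'_def[abs_def])
    next
      case False
      then show ?thesis using cont ij by (simp add: c'_def[abs_def])
    qed
  qed auto
  moreover have "L2_set (\<lambda>p. c p 1 - c p 0) ?I = L_dist n L K"
    by (simp add: L2_set_def L_dist_def sum_lower_triangle c_def ends power2_commute)
  moreover have "L2_set (\<lambda>p. c' p t) ?I = sqrt (L_metric n (\<gamma> t) (\<gamma>' t) (\<gamma>' t))" for t
    by (simp add: L2_set_def L_metric_def sum_lower_triangle c'_def power2_eq_square)
  ultimately show ?thesis by (simp add: L_length_def)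
qed

lemma L_dist_attained:
  assumes "L \<in> pos_lower n" "K \<in> pos_lower n"
  obtains \<gamma> \<gamma>' where "L_curve n L K \<gamma> \<gamma>'" "L_length n \<gamma> \<gamma>' = L_dist n L K"
proof
  define e where "e t j = exp ((1 - t) * ln (L $$ (j, j)) + t * ln (K $$ (j, j)))" for t j
  define \<gamma> where "\<gamma> t = Matrix.mat n n (\<lambda>(i, j). if i = j then e t j
    else (1 - t) * L $$ (i, j) + t * K $$ (i, j))" for t
  define \<gamma>' where "\<gamma>' t = Matrix.mat n n (\<lambda>(i, j). if i = j
    then e t j * (ln (K $$ (j, j)) - ln (L $$ (j, j))) else K $$ (i, j) - L $$ (i, j))" for t
  have [simp]: "L \<in> carrier_mat n n" "K \<in> carrier_mat n n"
    and pos: "j < n \<Longrightarrow> L $$ (j, j) > 0" "j < n \<Longrightarrow> K $$ (j, j) > 0"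
    and up: "i < j \<Longrightarrow> j < n \<Longrightarrow> L $$ (i, j) = 0" "i < j \<Longrightarrow> j < n \<Longrightarrow> K $$ (i, j) = 0" for i j
    using assms by (auto simp: pos_lower_def)
  show "L_curve n L K \<gamma> \<gamma>'"
    unfolding L_curve_def
  proof (intro conjI ballI allI impI)
    show "\<gamma> 0 = L" "\<gamma> 1 = K"
      by (rule eq_matI; use pos carrier_matD[of L n n] carrier_matD[of K n n] in \<open>simp add: \<gamma>_def e_def\<close>)+
    show "\<gamma> t \<in> pos_lower n" for t
      using up by (auto simp: \<gamma>_def pos_lower_def e_def)
    fix i j assume ij: "i < n" "j < n"
    show "((\<lambda>s. \<gamma> s $$ (i, j)) has_real_derivative \<gamma>' t $$ (i, j)) (at t within {0..1})" for t
    proof (cases "i = j")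
      case True
      have "((\<lambda>s. e s j) has_real_derivative e t j * (ln (K $$ (j, j)) - ln (L $$ (j, j))))
          (at t within {0..1})"
        unfolding e_def by (rule derivative_eq_intros refl | simp)+
      then show ?thesis using True ij by (simp add: \<gamma>_def \<gamma>'_def)
    next
      case False
      have "((\<lambda>s. (1 - s) * L $$ (i, j) + s * K $$ (i, j)) has_real_derivative
          K $$ (i, j) - L $$ (i, j)) (at t within {0..1})"
        by (rule derivative_eq_intros refl | simp)+
      then show ?thesis using False ij by (simp add: \<gamma>_def \<gamma>'_def)
    qed
    show "continuous_on {0..1} (\<lambda>t. \<gamma>' t $$ (i, j))"
      using ij by (cases "i = j") (auto simp: \<gamma>'_def e_def intro!: continuous_intros)
  qed
  have "sqrt (L_metric n (\<gamma> t) (\<gamma>' t) (\<gamma>' t)) = L_dist n L K" for t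
  proof -
    have "(\<Sum>i<n. \<Sum>j<i. \<gamma>' t $$ (i, j) * \<gamma>' t $$ (i, j)) =
        (\<Sum>i<n. \<Sum>j<i. (L $$ (i, j) - K $$ (i, j))\<^sup>2)"
      by (intro sum.cong refl) (auto simp: \<gamma>'_def power2_eq_square algebra_simps)
    moreover have "(\<Sum>j<n. \<gamma>' t $$ (j, j) * \<gamma>' t $$ (j, j) / (\<gamma> t $$ (j, j))\<^sup>2) =
        (\<Sum>j<n. (ln (L $$ (j, j)) - ln (K $$ (j, j)))\<^sup>2)"
    proof (intro sum.cong refl)
      fix j assume "j \<in> {..<n}"
      moreover have "e t j \<noteq> 0" by (simp add: e_def)
      ultimately show "\<gamma>' t $$ (j, j) * \<gamma>' t $$ (j, j) / (\<gamma> t $$ (j, j))\<^sup>2 =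
          (ln (L $$ (j, j)) - ln (K $$ (j, j)))\<^sup>2"
        by (simp add: \<gamma>_def \<gamma>'_def power2_eq_square) (simp add: algebra_simps)
    qed
    ultimately show ?thesis by (simp add: L_metric_def L_dist_def)
  qed
  then show "L_length n \<gamma> \<gamma>' = L_dist n L K" by (simp add: L_length_def)
qed

lemma L_dist_eq_Riemannian_distance:
  assumes "L \<in> pos_lower n" "K \<in> pos_lower n"
  shows "L_dist n L K = Inf {L_length n \<gamma> \<gamma>' | \<gamma> \<gamma>'. L_curve n L K \<gamma> \<gamma>'}"
proof (rule cInf_eq_minimum[symmetric])
  obtain \<gamma> \<gamma>' where "L_curve n L K \<gamma> \<gamma>'" "L_length n \<gamma> \<gamma>' = L_dist n L K"
    using L_dist_attained[OF assms] .
  then show "L_dist n L K \<in> {L_length n \<gamma> \<gamma>' | \<gamma> \<gamma>'. L_curve n L K \<gamma> \<gamma>'}"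
    by (intro CollectI exI[of _ \<gamma>] exI[of _ \<gamma>'] conjI) simp_all
next
  fix l assume "l \<in> {L_length n \<gamma> \<gamma>' | \<gamma> \<gamma>'. L_curve n L K \<gamma> \<gamma>'}"
  then show "L_dist n L K \<le> l"
    using L_dist_le_length by blast
qed


text \<open>Transport along a bijection \<open>f\<close> from the carrier of \<open>G\<close> onto \<open>B\<close>.\<close>

definition transport_group :: "('a \<Rightarrow> 'b) \<Rightarrow> 'a monoid \<Rightarrow> 'b set \<Rightarrow> 'b monoid" where
  "transport_group f G B = \<lparr>carrier = B,
     mult = (\<lambda>x y. f (inv_into (carrier G) f x \<otimes>\<^bsub>G\<^esub> inv_into (carrier G) f y)),
     one = f \<one>\<^bsub>G\<^esub>\<rparr>"

definition transport_dist :: "('a \<Rightarrow> 'b) \<Rightarrow> 'a set \<Rightarrow> ('a \<Rightarrow> 'a \<Rightarrow> real) \<Rightarrow> 'b \<Rightarrow> 'b \<Rightarrow> real" where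
  "transport_dist f A d x y = d (inv_into A f x) (inv_into A f y)"

definition LPM_map :: "nat \<Rightarrow> (nat \<Rightarrow> real) \<Rightarrow> real mat \<Rightarrow> real mat" where
  "LPM_map n \<epsilon> L = L * sign_diag n \<epsilon> * transpose_mat L"

definition TPM_map :: "nat \<Rightarrow> (nat \<Rightarrow> real) \<Rightarrow> real mat \<Rightarrow> real mat" where
  "TPM_map n \<epsilon> L =
     transpose_mat L * (antidiag_perm n * sign_diag n \<epsilon> * antidiag_perm n) * L"

definition LPM_group :: "nat \<Rightarrow> (nat \<Rightarrow> real) \<Rightarrow> real mat monoid" where
  "LPM_group n \<epsilon> = transport_group (LPM_map n \<epsilon>) (L_group n) (LPM n \<epsilon>)"

definition LPM_dist :: "nat \<Rightarrow> (nat \<Rightarrow> real) \<Rightarrow> real mat \<Rightarrow> real mat \<Rightarrow> real" where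
  "LPM_dist n \<epsilon> = transport_dist (LPM_map n \<epsilon>) (pos_lower n) (L_dist n)"

definition TPM_group :: "nat \<Rightarrow> (nat \<Rightarrow> real) \<Rightarrow> real mat monoid" where
  "TPM_group n \<epsilon> = transport_group (TPM_map n \<epsilon>) (L_group n) (TPM n \<epsilon>)"

definition TPM_dist :: "nat \<Rightarrow> (nat \<Rightarrow> real) \<Rightarrow> real mat \<Rightarrow> real mat \<Rightarrow> real" where
  "TPM_dist n \<epsilon> = transport_dist (TPM_map n \<epsilon>) (pos_lower n) (L_dist n)"


definition euclidean_vec_dist :: "nat \<Rightarrow> real vec \<Rightarrow> real vec \<Rightarrow> real" where
  "euclidean_vec_dist m v w = L2_set (\<lambda>i. vec_index v i - vec_index w i) {..<m}"

definition abelian_metric_group :: "'a monoid \<Rightarrow> ('a \<Rightarrow> 'a \<Rightarrow> real) \<Rightarrow> bool" where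
  "abelian_metric_group G d \<longleftrightarrow> comm_group G \<and> Metric_space (carrier G) d"

text \<open>An isometry has to preserve distances; surjectivity is part of \<open>iso\<close>.\<close>

definition isometrically_isomorphic ::
  "'a monoid \<Rightarrow> ('a \<Rightarrow> 'a \<Rightarrow> real) \<Rightarrow> 'b monoid \<Rightarrow> ('b \<Rightarrow> 'b \<Rightarrow> real) \<Rightarrow> bool" where
  "isometrically_isomorphic G d H e \<longleftrightarrow>
     (\<exists>f \<in> iso G H. \<forall>x\<in>carrier G. \<forall>y\<in>carrier G. e (f x) (f y) = d x y)"

definition separable_metric :: "'a monoid \<Rightarrow> ('a \<Rightarrow> 'a \<Rightarrow> real) \<Rightarrow> bool" where
  "separable_metric G d \<longleftrightarrow> separable_space (Metric_space.mtopology (carrier G) d)"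

definition complete_metric :: "'a monoid \<Rightarrow> ('a \<Rightarrow> 'a \<Rightarrow> real) \<Rightarrow> bool" where
  "complete_metric G d \<longleftrightarrow> Metric_space.mcomplete (carrier G) d"

end

theory Submission
  imports Defs
begin

text \<open>In the coordinates \<open>l\<^sub>i\<^sub>j\<close> (for \<open>i > j\<close>) and \<open>log l\<^sub>j\<^sub>j\<close> both the group operation and the distance of
  lower triangular matrices are Euclidean. The claim for \<open>LPM\<close> reduces to the bijectivity of
  \<open>L \<mapsto> L D L\<^sup>T\<close>: injectivity is seen column by column, and surjectivity is obtained by bordering, where
  the sign of the new leading minor makes the new diagonal entry real and positive. Reversing the
  order of rows and columns turns leading into trailing minors and so reduces \<open>TPM\<close> to \<open>LPM\<close>.\<close>

subsection \<open>Groups isometric to Euclidean space\<close>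

text \<open>Coordinates are 1-Lipschitz: this turns distance zero into equality of entries, and
  metric Cauchy sequences into Cauchy sequences of reals.\<close>

lemma abs_diff_le_euclidean_vec_dist:
  assumes "i < m"
  shows "\<bar>vec_index v i - vec_index w i\<bar> \<le> euclidean_vec_dist m v w"
  using member_le_L2_set[of "{..<m}" i "\<lambda>i. \<bar>vec_index v i - vec_index w i\<bar>"] assms
  by (simp add: euclidean_vec_dist_def L2_set_def)

text \<open>\<open>f\<close> plays the role of a global isometric chart. Nonnegativity and symmetry
  of \<open>d\<close> are asked for all arguments, not only on \<open>M\<close>, because the locale
  \<open>Metric_space\<close> asks for them in this form.\<close>

context
  fixes f :: "'a \<Rightarrow> real vec" and M :: "'a set" and d :: "'a \<Rightarrow> 'a \<Rightarrow> real" and m :: nat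
  assumes bij: "bij_betw f M (carrier_vec m)"
    and isom: "\<And>x y. x \<in> M \<Longrightarrow> y \<in> M \<Longrightarrow> euclidean_vec_dist m (f x) (f y) = d x y"
    and nonneg: "\<And>x y. 0 \<le> d x y" and commute: "\<And>x y. d x y = d y x"
begin

lemma Metric_space_isometric_euclidean: "Metric_space M d"
proof
  fix x y assume xy: "x \<in> M" "y \<in> M"
  have "f x = f y" if "d x y = 0"
  proof (rule eq_vecI)
    show "dim_vec (f x) = dim_vec (f y)"
      using bij_betwE[OF bij] xy by (metis carrier_vecD)
    fix i assume "i < dim_vec (f y)"
    then have "i < m" using bij_betwE[OF bij] xy by (metis carrier_vecD)
    then show "vec_index (f x) i = vec_index (f y) i"
      using abs_diff_le_euclidean_vec_dist[of i m "f x" "f y"] isom[OF xy] that by simp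
  qed
  moreover have "d x x = 0"
    using isom[OF xy(1) xy(1)] by (simp add: euclidean_vec_dist_def L2_set_def)
  ultimately show "d x y = 0 \<longleftrightarrow> x = y"
    using bij_betw_imp_inj_on[OF bij] xy by (auto dest: inj_onD)
next
  fix x y z assume xyz: "x \<in> M" "y \<in> M" "z \<in> M"
  show "d x z \<le> d x y + d y z"
    using L2_set_triangle_ineq[of "\<lambda>i. vec_index (f x) i - vec_index (f y) i"
        "\<lambda>i. vec_index (f y) i - vec_index (f z) i" "{..<m}"]
    by (simp add: isom[symmetric] xyz euclidean_vec_dist_def)
qed (simp_all add: nonneg commute)

interpretation Metric_space M d
  by (rule Metric_space_isometric_euclidean)

text \<open>Completeness of the reals gives a limit in each coordinate; the vector of these limits
  is pulled back through \<open>f\<close>, and finitely many coordinate limits give convergence in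
  \<open>d\<close>.\<close>

lemma mcomplete_isometric_euclidean: "mcomplete"
  unfolding mcomplete_def
proof (intro allI impI)
  fix \<sigma> assume \<sigma>: "MCauchy \<sigma>"
  then have \<sigma>M: "\<sigma> k \<in> M" for k by (auto simp: MCauchy_def)
  have "\<exists>l. (\<lambda>k. vec_index (f (\<sigma> k)) i) \<longlonglongrightarrow> l" if "i < m" for i
  proof -
    have "Cauchy (\<lambda>k. vec_index (f (\<sigma> k)) i)"
    proof (rule metric_CauchyI)
      fix e :: real assume "0 < e"
      then obtain N where "\<And>k k'. N \<le> k \<Longrightarrow> N \<le> k' \<Longrightarrow> d (\<sigma> k) (\<sigma> k') < e"
        using \<sigma> unfolding MCauchy_def by meson
      then show "\<exists>N. \<forall>k\<ge>N. \<forall>k'\<ge>N. dist (vec_index (f (\<sigma> k)) i) (vec_index (f (\<sigma> k')) i) < e"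
        using abs_diff_le_euclidean_vec_dist[OF that] isom[OF \<sigma>M \<sigma>M]
        by (metis dist_real_def le_less_trans)
    qed
    then show ?thesis by (simp add: Cauchy_convergent_iff convergent_def)
  qed
  then obtain l where l: "\<And>i. i < m \<Longrightarrow> (\<lambda>k. vec_index (f (\<sigma> k)) i) \<longlonglongrightarrow> l i" by metis
  define x where "x = inv_into M f (Matrix.vec m l)"
  have x: "x \<in> M" "f x = Matrix.vec m l"
    using bij unfolding x_def by (auto simp: bij_betw_def intro!: inv_into_into f_inv_into_f)
  \<comment> \<open>The limit is written in the shape that the limit rules produce; it is 0.\<close>
  have "(\<lambda>k. sqrt (\<Sum>i<m. (vec_index (f (\<sigma> k)) i - l i)\<^sup>2)) \<longlonglongrightarrow> sqrt (\<Sum>i<m. (l i - l i)\<^sup>2)"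
    by (intro tendsto_intros l) simp
  then have "(\<lambda>k. d (\<sigma> k) x) \<longlonglongrightarrow> 0"
    by (simp add: isom[symmetric] \<sigma>M x euclidean_vec_dist_def L2_set_def)
  then have "limitin mtopology \<sigma> x sequentially"
    using \<sigma>M x by (simp add: limitin_metric_dist_null)
  then show "\<exists>x. limitin mtopology \<sigma> x sequentially" ..
qed

lemma separable_isometric_euclidean: "separable_space mtopology"
proof -
  \<comment> \<open>The dense set consists of the preimages of rational vectors. \<open>PiE\<close>
    pins the functions to \<open>undefined\<close> outside \<open>{..<m}\<close>; without this there
    would be uncountably many of them.\<close>
  define C where "C = (\<lambda>q. inv_into M f (Matrix.vec m q)) ` (PiE {..<m} (\<lambda>_. \<rat>))"
  have in_M: "inv_into M f (Matrix.vec m q) \<in> M"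
    and f_inv: "f (inv_into M f (Matrix.vec m q)) = Matrix.vec m q" for q
    using bij by (auto simp: bij_betw_def intro!: inv_into_into f_inv_into_f)
  have "countable C"
    unfolding C_def by (intro countable_image countable_PiE countable_rat) simp
  moreover have "C \<subseteq> M" using in_M by (auto simp: C_def)
  moreover have "mtopology closure_of C = M"
  proof -
    have "\<exists>y\<in>C. y \<in> mball x r" if "x \<in> M" "0 < r" for x r
    proof -
      \<comment> \<open>The errors of \<open>m\<close> coordinates, each below
        \<open>r / (m + 1)\<close>, add up to less than \<open>r\<close>; the shift by 1 also covers
        \<open>m = 0\<close>.\<close>
      have "\<exists>q\<in>\<rat>. \<bar>vec_index (f x) i - q\<bar> < r / (m + 1)" for i
      proof -
        obtain q where "q \<in> \<rat>" "vec_index (f x) i < q" "q < vec_index (f x) i + r / (m + 1)"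
          using Rats_dense_in_real[of "vec_index (f x) i" "vec_index (f x) i + r / (m + 1)"] \<open>0 < r\<close>
          by auto
        then show ?thesis by (intro bexI[of _ q]) auto
      qed
      then obtain q where q: "\<And>i. q i \<in> \<rat>" "\<And>i. \<bar>vec_index (f x) i - q i\<bar> < r / (m + 1)" by metis
      define y where "y = inv_into M f (Matrix.vec m q)"
      \<comment> \<open>\<open>q\<close> was chosen on all of \<open>nat\<close>; its restriction
        yields the same vector and is a member of the \<open>PiE\<close> set.\<close>
      have "Matrix.vec m q = Matrix.vec m (restrict q {..<m})" by auto
      then have "y \<in> C" unfolding C_def y_def using q(1)
        by (intro image_eqI[of _ _ "restrict q {..<m}"]) (simp_all add: PiE_iff)
      have "d x y = L2_set (\<lambda>i. vec_index (f x) i - q i) {..<m}"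
        using that in_M f_inv by (simp add: isom[symmetric] y_def euclidean_vec_dist_def L2_set_def)
      also have "\<dots> \<le> (\<Sum>i<m. \<bar>vec_index (f x) i - q i\<bar>)" by (rule L2_set_le_sum_abs)
      also have "\<dots> \<le> (\<Sum>i<m. r / (m + 1))" using q(2) by (intro sum_mono less_imp_le)
      also have "\<dots> < r" using \<open>0 < r\<close> by (simp add: field_simps)
      finally show ?thesis using that in_M \<open>y \<in> C\<close> by (auto simp: y_def)
    qed
    then show ?thesis by (auto simp: metric_closure_of)
  qed
  ultimately show ?thesis by (auto simp: separable_space_def)
qed

end

text \<open>Both sides of each group law have the same image in \<open>H\<close>, so injectivity of
  \<open>f\<close> gives the law in \<open>G\<close>; surjectivity supplies a preimage of the
  inverse.\<close>

lemma comm_group_bij_hom: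
  assumes H: "comm_group H" and bij: "bij_betw f (carrier G) (carrier H)"
    and closed: "\<And>x y. x \<in> carrier G \<Longrightarrow> y \<in> carrier G \<Longrightarrow> x \<otimes>\<^bsub>G\<^esub> y \<in> carrier G"
    and hom: "\<And>x y. x \<in> carrier G \<Longrightarrow> y \<in> carrier G \<Longrightarrow> f (x \<otimes>\<^bsub>G\<^esub> y) = f x \<otimes>\<^bsub>H\<^esub> f y"
    and one: "\<one>\<^bsub>G\<^esub> \<in> carrier G" "f \<one>\<^bsub>G\<^esub> = \<one>\<^bsub>H\<^esub>"
  shows "comm_group G"
proof -
  interpret H: comm_group H by (rule H)
  have fH: "f x \<in> carrier H" if "x \<in> carrier G" for x using bij_betwE[OF bij] that by blast
  have eqI: "x = y" if "x \<in> carrier G" "y \<in> carrier G" "f x = f y" for x y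
    using bij_betw_imp_inj_on[OF bij] that by (auto dest: inj_onD)
  have inv: "\<exists>y\<in>carrier G. y \<otimes>\<^bsub>G\<^esub> x = \<one>\<^bsub>G\<^esub>" if x: "x \<in> carrier G" for x
  proof -
    obtain y where y: "y \<in> carrier G" "f y = inv\<^bsub>H\<^esub> (f x)"
      using bij H.inv_closed[OF fH[OF x]] by (metis bij_betw_def imageE)
    have "y \<otimes>\<^bsub>G\<^esub> x = \<one>\<^bsub>G\<^esub>"
      by (rule eqI) (use x y fH in \<open>simp_all add: closed one hom\<close>)
    with y show ?thesis by blast
  qed
  show ?thesis
  proof (rule comm_groupI)
    fix x y z assume "x \<in> carrier G" "y \<in> carrier G" "z \<in> carrier G"
    then show "x \<otimes>\<^bsub>G\<^esub> y \<otimes>\<^bsub>G\<^esub> z = x \<otimes>\<^bsub>G\<^esub> (y \<otimes>\<^bsub>G\<^esub> z)"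
      by (intro eqI) (simp_all add: closed hom fH H.m_assoc)
  next
    fix x y assume "x \<in> carrier G" "y \<in> carrier G"
    then show "x \<otimes>\<^bsub>G\<^esub> y = y \<otimes>\<^bsub>G\<^esub> x"
      by (intro eqI) (simp_all add: closed hom fH H.m_comm)
  next
    fix x assume "x \<in> carrier G"
    then show "\<one>\<^bsub>G\<^esub> \<otimes>\<^bsub>G\<^esub> x = x"
      by (intro eqI) (simp_all add: closed hom fH one)
  qed (use closed one inv in auto)
qed

text \<open>That \<open>G\<close> is a group is a conclusion here: it follows from the bijection and
  additivity of \<open>f\<close>, so no associativity or inverse has to be computed with
  matrices.\<close>

lemma isometric_euclidean_group:
  assumes bij: "bij_betw f (carrier G) (carrier_vec m)"
    and closed: "\<And>x y. x \<in> carrier G \<Longrightarrow> y \<in> carrier G \<Longrightarrow> x \<otimes>\<^bsub>G\<^esub> y \<in> carrier G"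
    and hom: "\<And>x y. x \<in> carrier G \<Longrightarrow> y \<in> carrier G \<Longrightarrow> f (x \<otimes>\<^bsub>G\<^esub> y) = f x + f y"
    and one: "\<one>\<^bsub>G\<^esub> \<in> carrier G" "f \<one>\<^bsub>G\<^esub> = 0\<^sub>v m"
    and isom: "\<And>x y. x \<in> carrier G \<Longrightarrow> y \<in> carrier G \<Longrightarrow> euclidean_vec_dist m (f x) (f y) = d x y"
    and nonneg: "\<And>x y. 0 \<le> d x y" and commute: "\<And>x y. d x y = d y x"
  shows "abelian_metric_group G d \<and>
    isometrically_isomorphic G d (monoid_vec TYPE(real) m) (euclidean_vec_dist m) \<and>
    separable_metric G d \<and> complete_metric G d"
proof -
  have "f \<in> iso G (monoid_vec TYPE(real) m)"
    using bij bij_betwE[OF bij] hom by (auto simp: iso_def hom_def monoid_vec_simps)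
  moreover have "comm_group G"
    by (rule comm_group_bij_hom[OF comm_group_vec, of f])
      (use assms in \<open>simp_all add: monoid_vec_simps\<close>)
  ultimately show ?thesis
    using Metric_space_isometric_euclidean[OF bij isom nonneg commute]
      mcomplete_isometric_euclidean[OF bij isom nonneg commute]
      separable_isometric_euclidean[OF bij isom nonneg commute] isom
    by (auto simp: abelian_metric_group_def isometrically_isomorphic_def separable_metric_def
        complete_metric_def)
qed

text \<open>Composing \<open>f\<close> with the inverse of \<open>g\<close> gives coordinates on
  \<open>B\<close>. The inverse undoes the outer \<open>g\<close> in the transported product, so
  additivity and isometry carry over from \<open>f\<close>.\<close>

lemma isometric_euclidean_transport:
  assumes f: "bij_betw f (carrier G) (carrier_vec m)" and g: "bij_betw g (carrier G) B"
    and closed: "\<And>x y. x \<in> carrier G \<Longrightarrow> y \<in> carrier G \<Longrightarrow> x \<otimes>\<^bsub>G\<^esub> y \<in> carrier G"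
    and hom: "\<And>x y. x \<in> carrier G \<Longrightarrow> y \<in> carrier G \<Longrightarrow> f (x \<otimes>\<^bsub>G\<^esub> y) = f x + f y"
    and one: "\<one>\<^bsub>G\<^esub> \<in> carrier G" "f \<one>\<^bsub>G\<^esub> = 0\<^sub>v m"
    and isom: "\<And>x y. x \<in> carrier G \<Longrightarrow> y \<in> carrier G \<Longrightarrow> euclidean_vec_dist m (f x) (f y) = d x y"
    and nonneg: "\<And>x y. 0 \<le> d x y" and commute: "\<And>x y. d x y = d y x"
  defines "H \<equiv> transport_group g G B" and "e \<equiv> transport_dist g (carrier G) d"
  shows "abelian_metric_group H e \<and>
    isometrically_isomorphic H e (monoid_vec TYPE(real) m) (euclidean_vec_dist m) \<and>
    separable_metric H e \<and> complete_metric H e"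
proof (rule isometric_euclidean_group)
  let ?h = "inv_into (carrier G) g"
  have carrier: "carrier H = B" by (simp add: H_def transport_group_def)
  have h: "bij_betw ?h B (carrier G)" by (rule bij_betw_inv_into[OF g])
  have hG: "?h x \<in> carrier G" if "x \<in> carrier H" for x
    using bij_betwE[OF h] that carrier by blast
  have hg: "?h (g x) = x" if "x \<in> carrier G" for x
    using bij_betw_inv_into_left[OF g that] .
  show "bij_betw (f \<circ> ?h) (carrier H) (carrier_vec m)"
    unfolding carrier using h f by (rule bij_betw_trans)
  show "x \<otimes>\<^bsub>H\<^esub> y \<in> carrier H" if "x \<in> carrier H" "y \<in> carrier H" for x y
    using closed hG[OF that(1)] hG[OF that(2)] bij_betwE[OF g]
    by (simp add: H_def transport_group_def)
  show "(f \<circ> ?h) (x \<otimes>\<^bsub>H\<^esub> y) = (f \<circ> ?h) x + (f \<circ> ?h) y" if "x \<in> carrier H" "y \<in> carrier H" for x y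
    using hG[OF that(1)] hG[OF that(2)]
    by (simp add: H_def transport_group_def hg closed hom)
  show "\<one>\<^bsub>H\<^esub> \<in> carrier H" "(f \<circ> ?h) \<one>\<^bsub>H\<^esub> = 0\<^sub>v m"
    using one bij_betwE[OF g] by (simp_all add: H_def transport_group_def hg)
  show "euclidean_vec_dist m ((f \<circ> ?h) x) ((f \<circ> ?h) y) = e x y"
    if "x \<in> carrier H" "y \<in> carrier H" for x y
    using isom hG that by (simp add: e_def transport_dist_def)
qed (simp_all add: e_def transport_dist_def nonneg commute)

subsection \<open>Signed Cholesky factorisation\<close>

text \<open>Forward substitution: the unknown \<open>x k\<close> does not occur in the equations
  before the \<open>k\<close>-th, so choosing it to satisfy that equation keeps the earlier
  ones.\<close>

lemma solve_lower_triangular: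
  fixes l :: "nat \<Rightarrow> nat \<Rightarrow> 'a :: field"
  assumes "\<And>i. i < k \<Longrightarrow> l i i \<noteq> 0"
  obtains x where "\<And>i. i < k \<Longrightarrow> (\<Sum>m\<le>i. l i m * x m) = b i"
  using assms
proof (induction k arbitrary: thesis)
  case 0
  then show ?case by simp
next
  case (Suc k)
  then obtain x where x: "\<And>i. i < k \<Longrightarrow> (\<Sum>m\<le>i. l i m * x m) = b i"
    using less_SucI by blast
  define y where "y = x(k := (b k - (\<Sum>m<k. l k m * x m)) / l k k)"
  have "(\<Sum>m\<le>i. l i m * y m) = b i" if "i < Suc k" for i
  proof (cases "i = k")
    case True
    have "(\<Sum>m<k. l k m * y m) = (\<Sum>m<k. l k m * x m)"
      by (intro sum.cong) (auto simp: y_def)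
    then show ?thesis
      using True Suc.prems(2)[of k] by (simp add: lessThan_Suc_atMost[symmetric] y_def)
  next
    case False
    then have "i < k" using that by simp
    moreover from this have "(\<Sum>m\<le>i. l i m * y m) = (\<Sum>m\<le>i. l i m * x m)"
      by (intro sum.cong) (auto simp: y_def)
    ultimately show ?thesis using x by simp
  qed
  then show ?case by (rule Suc.prems(1))
qed

text \<open>This is the \<open>(i, j)\<close> entry of L D L^T for lower triangular L. Cutting the
  sum at \<open>min i j\<close> makes it independent of the values of \<open>l\<close> above the
  diagonal and of the order of the matrix, so that blocks of different orders share one
  \<open>l\<close>.\<close>

definition ldl :: "(nat \<Rightarrow> real) \<Rightarrow> (nat \<Rightarrow> nat \<Rightarrow> real) \<Rightarrow> nat \<Rightarrow> nat \<Rightarrow> real" where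
  "ldl d l i j = (\<Sum>m\<le>min i j. l i m * d m * l j m)"

lemma ldl_commute: "ldl d l i j = ldl d l j i"
  by (simp add: ldl_def min.commute mult_ac)

lemma ldl_cong:
  assumes "\<And>m. m \<le> i \<Longrightarrow> l i m = l' i m" "\<And>m. m \<le> j \<Longrightarrow> l j m = l' j m"
    "\<And>m. m \<le> min i j \<Longrightarrow> d m = d' m"
  shows "ldl d l i j = ldl d' l' i j"
  unfolding ldl_def by (intro sum.cong) (simp_all add: assms)

lemma ldl_diag: "ldl d l k k = (\<Sum>m<k. d m * (l k m)\<^sup>2) + d k * (l k k)\<^sup>2"
  by (simp add: ldl_def lessThan_Suc_atMost[symmetric] power2_eq_square mult_ac)

lemma index_LDL:
  assumes L: "L \<in> carrier_mat n n" "\<And>i j. i < j \<Longrightarrow> j < n \<Longrightarrow> L $$ (i, j) = 0" and ij: "i < n" "j < n"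
  shows "(L * mat_diag n d * transpose_mat L) $$ (i, j) = ldl d (\<lambda>i j. L $$ (i, j)) i j"
proof -
  have "(L * mat_diag n d * transpose_mat L) $$ (i, j) = (\<Sum>m<n. L $$ (i, m) * d m * L $$ (j, m))"
    using L(1) ij by (simp add: mat_diag_mult_right[OF L(1)] scalar_prod_def atLeast0LessThan)
  \<comment> \<open>Beyond \<open>min i j\<close> one of the two factors from \<open>L\<close> lies
    above the diagonal.\<close>
  also have "\<dots> = (\<Sum>m\<le>min i j. L $$ (i, m) * d m * L $$ (j, m))"
    using ij by (intro sum.mono_neutral_right) (auto intro!: L(2))
  finally show ?thesis by (simp add: ldl_def)
qed

lemma LDL_eq_mat_ldl:
  assumes "L \<in> carrier_mat n n" "\<And>i j. i < j \<Longrightarrow> j < n \<Longrightarrow> L $$ (i, j) = 0"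
  shows "L * mat_diag n d * transpose_mat L =
    Matrix.mat n n (\<lambda>(i, j). ldl d (\<lambda>i j. L $$ (i, j)) i j)"
  by (rule eq_matI) (use assms(1) index_LDL[OF assms] in \<open>simp_all add: mat_diag_def\<close>)

text \<open>Deleting the entries of \<open>l\<close> above the diagonal does not change
  \<open>ldl\<close>, and then the matrix is a product of triangular factors. \<open>d\<close> is
  arbitrary, since a pivot that is not a sign is inserted later.\<close>

lemma det_ldl: "det (Matrix.mat n n (\<lambda>(i, j). ldl d l i j)) = (\<Prod>m<n. d m * (l m m)\<^sup>2)"
proof -
  define L where "L = Matrix.mat n n (\<lambda>(i, j). if j \<le> i then l i j else 0)"
  have L: "L \<in> carrier_mat n n" and upper: "\<And>i j. i < j \<Longrightarrow> j < n \<Longrightarrow> L $$ (i, j) = 0"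
    by (auto simp: L_def)
  have detL: "det L = (\<Prod>m<n. l m m)"
    by (subst det_lower_triangular[of n])
      (simp_all add: L_def prod_list_diag_prod atLeast0LessThan)
  have detD: "det (mat_diag n d) = (\<Prod>m<n. d m)"
    by (subst det_lower_triangular[of n])
      (simp_all add: mat_diag_def prod_list_diag_prod atLeast0LessThan)
  have "Matrix.mat n n (\<lambda>(i, j). ldl d l i j) =
      Matrix.mat n n (\<lambda>(i, j). ldl d (\<lambda>i j. L $$ (i, j)) i j)"
    by (intro cong_mat) (auto simp: L_def intro!: ldl_cong)
  also have "\<dots> = L * mat_diag n d * transpose_mat L"
    by (simp add: LDL_eq_mat_ldl[OF L upper])
  also have "det \<dots> = det L * det (mat_diag n d) * det L"
    using L by (simp add: det_mult[of _ n] det_transpose[of _ n])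
  finally show ?thesis
    by (simp add: detL detD prod.distrib power2_eq_square mult_ac)
qed

lemma sgn_prod_eq: "sgn (prod f A) = (\<Prod>x\<in>A. sgn (f x :: 'b :: linordered_idom))"
  by (induction A rule: infinite_finite_induct) (simp_all add: sgn_mult)

lemma sgn_mult_power2:
  fixes x :: real
  assumes "s \<in> {1, -1}" "x \<noteq> 0"
  shows "sgn (s * x\<^sup>2) = s"
  using assms by (auto simp: sgn_if)

text \<open>Induction on the order. The factor of the leading block is kept, its new row solves a
  triangular system, and the sign of the largest minor shows that the remaining diagonal entry can
  be a real square root.\<close>

lemma ldl_exists:
  fixes a :: "nat \<Rightarrow> nat \<Rightarrow> real"
  assumes sym: "\<And>i j. i < n \<Longrightarrow> j < n \<Longrightarrow> a i j = a j i"
    and sgn: "\<And>k. k \<in> {1..n} \<Longrightarrow> sgn (det (Matrix.mat k k (\<lambda>(i, j). a i j))) = (\<Prod>m<k. d m)"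
    and d: "\<And>m. m < n \<Longrightarrow> d m \<in> {1, -1}"
  obtains l where "\<And>i. i < n \<Longrightarrow> l i i > 0" "\<And>i j. i < n \<Longrightarrow> j < n \<Longrightarrow> a i j = ldl d l i j"
  using assms
proof (induction n arbitrary: thesis)
  case 0
  then show ?case by simp
next
  case (Suc k)
  obtain l where l: "\<And>i. i < k \<Longrightarrow> l i i > 0" "\<And>i j. i < k \<Longrightarrow> j < k \<Longrightarrow> a i j = ldl d l i j"
  proof (rule Suc.IH)
    show "sgn (det (Matrix.mat k' k' (\<lambda>(i, j). a i j))) = (\<Prod>m<k'. d m)" if "k' \<in> {1..k}" for k'
      using Suc.prems(3)[of k'] that by simp
  qed (use Suc.prems(2,4) in auto)
  have d0: "d m \<noteq> 0" "d m * d m = 1" if "m \<le> k" for m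
    using Suc.prems(4)[of m] that by auto
  have l0: "l m m \<noteq> 0" if "m < k" for m
    using l(1)[OF that] by simp
  have pivot: "l i i * d i \<noteq> 0" if "i < k" for i
    using d0(1)[of i] l0[OF that] that by simp
  \<comment> \<open>The new row \<open>x\<close> has to reproduce the new column of \<open>a\<close>
    above the corner, which is a lower triangular system with diagonal entries
    \<open>l i i * d i\<close>.\<close>
  obtain x where x: "\<And>i. i < k \<Longrightarrow> (\<Sum>m\<le>i. (l i m * d m) * x m) = a i k"
    using solve_lower_triangular[of k "\<lambda>i m. l i m * d m" "\<lambda>i. a i k", OF pivot] by blast
  \<comment> \<open>The Schur complement of the leading block; the last minor forces its sign.\<close>
  define s where "s = a k k - (\<Sum>m<k. d m * (x m)\<^sup>2)"
  \<comment> \<open>Only the product \<open>d' k * (l' k k)\<^sup>2\<close> matters at the corner.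
    This is applied twice: to a unit diagonal entry with pivot \<open>s\<close>, and to the pivot
    \<open>d k\<close> with diagonal entry \<open>sqrt \<bar>s\<bar>\<close>.\<close>
  have row: "a i j = ldl d' l' i j"
    if ij: "i < Suc k" "j < Suc k" and d': "\<And>m. m < k \<Longrightarrow> d' m = d m"
      and l': "\<And>i m. i < k \<Longrightarrow> l' i m = l i m" "\<And>m. m < k \<Longrightarrow> l' k m = x m"
      and corner: "d' k * (l' k k)\<^sup>2 = s" for i j d' l'
  proof -
    have less: "a i k = ldl d' l' i k" if "i < k" for i
      unfolding x[OF that, symmetric] ldl_def using that by (intro sum.cong) (auto simp: l' d')
    show ?thesis
    proof (cases "i = k"; cases "j = k")
      assume "i = k" "j = k"
      moreover have "(\<Sum>m<k. d' m * (l' k m)\<^sup>2) = (\<Sum>m<k. d m * (x m)\<^sup>2)"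
        by (intro sum.cong) (simp_all add: l' d')
      ultimately show ?thesis
        using corner by (simp add: ldl_diag s_def)
    next
      assume "i = k" "j \<noteq> k"
      then show ?thesis
        using less[of j] ij Suc.prems(2)[of j k] by (simp add: ldl_commute[of d' l' k j])
    next
      assume "i \<noteq> k" "j = k"
      then show ?thesis using less[of i] ij by simp
    next
      assume "i \<noteq> k" "j \<noteq> k"
      then have "i < k" "j < k" using ij by auto
      then show ?thesis
        using l(2)[of i j] by (auto simp: l' d' intro!: ldl_cong)
    qed
  qed
  \<comment> \<open>This factorisation is available before the sign of \<open>s\<close> is known;
    its determinant reveals that sign.\<close>
  define l\<^sub>1 where "l\<^sub>1 = l(k := x(k := 1))"
  define d\<^sub>1 where "d\<^sub>1 = d(k := s)"
  have "Matrix.mat (Suc k) (Suc k) (\<lambda>(i, j). a i j) =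
      Matrix.mat (Suc k) (Suc k) (\<lambda>(i, j). ldl d\<^sub>1 l\<^sub>1 i j)"
    by (intro cong_mat refl) (auto intro!: row simp: l\<^sub>1_def d\<^sub>1_def)
  then have "det (Matrix.mat (Suc k) (Suc k) (\<lambda>(i, j). a i j)) = (\<Prod>m<k. d m * (l m m)\<^sup>2) * s"
    by (simp add: det_ldl l\<^sub>1_def d\<^sub>1_def)
  \<comment> \<open>Squares contribute no sign, so the earlier pivots cancel on both sides and
    \<open>sgn s = d k\<close> remains; in particular \<open>s\<close> is nonzero.\<close>
  then have "(\<Prod>m<Suc k. d m) = (\<Prod>m<k. sgn (d m * (l m m)\<^sup>2)) * sgn s"
    using Suc.prems(3)[of "Suc k"] by (simp add: sgn_mult sgn_prod_eq)
  moreover have "(\<Prod>m<k. sgn (d m * (l m m)\<^sup>2)) = (\<Prod>m<k. d m)"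
    using Suc.prems(4) l0 by (intro prod.cong refl sgn_mult_power2) auto
  moreover have "(\<Prod>m<k. d m) \<noteq> 0" using d0 by auto
  ultimately have "sgn s = d k" by simp
  then have s: "d k * \<bar>s\<bar> = s" "s \<noteq> 0"
    using d0(1)[of k] sgn_mult_abs[of s] by auto
  define l\<^sub>2 where "l\<^sub>2 = l(k := x(k := sqrt \<bar>s\<bar>))"
  show ?case
  proof (rule Suc.prems(1)[of l\<^sub>2])
    show "l\<^sub>2 i i > 0" if "i < Suc k" for i
      using that l(1)[of i] s by (auto simp: l\<^sub>2_def)
    show "a i j = ldl d l\<^sub>2 i j" if "i < Suc k" "j < Suc k" for i j
      by (rule row[OF that]) (use s in \<open>auto simp: l\<^sub>2_def\<close>)
  qed
qed

text \<open>Column by column: once the earlier columns agree, column \<open>j\<close> determines the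
  products \<open>l i j * l j j\<close>. The case \<open>i = j\<close> with positivity gives the
  diagonal entry, and division gives the others.\<close>

lemma ldl_unique:
  assumes l: "\<And>i. i < n \<Longrightarrow> l i i > 0" and k: "\<And>i. i < n \<Longrightarrow> k i i > 0"
    and d: "\<And>m. m < n \<Longrightarrow> d m \<noteq> 0"
    and eq: "\<And>i j. j \<le> i \<Longrightarrow> i < n \<Longrightarrow> ldl d l i j = ldl d k i j"
    and ij: "j \<le> i" "i < n"
  shows "l i j = k i j"
  using ij
proof (induction j arbitrary: i rule: less_induct)
  case (less j)
  have split: "ldl d f i j = (\<Sum>m<j. f i m * d m * f j m) + f i j * d j * f j j" if "j \<le> i" for f i
    using that by (simp add: ldl_def lessThan_Suc_atMost[symmetric] min_absorb2)
  have col: "l i j * l j j = k i j * k j j" if i: "j \<le> i" "i < n" for i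
  proof -
    have "(\<Sum>m<j. l i m * d m * l j m) = (\<Sum>m<j. k i m * d m * k j m)"
      using less.IH i by (intro sum.cong) auto
    then have "d j * (l i j * l j j) = d j * (k i j * k j j)"
      using eq[OF i] unfolding split[OF i(1)] by (simp add: mult_ac)
    then show ?thesis using d[of j] i by simp
  qed
  have "l j j = k j j"
    using col[of j] less.prems l[of j] k[of j]
    by (simp add: power2_eq_square[symmetric] power2_eq_iff_nonneg)
  then show ?case
    using col[OF less.prems] k[of j] less.prems by simp
qed

section \<open>Minors as determinants of contiguous blocks\<close>

lemma submatrix_atLeastLessThan:
  assumes "a + k \<le> dim_row A" "b + l \<le> dim_col A"
  shows "submatrix A {a..<a + k} {b..<b + l} = Matrix.mat k l (\<lambda>(i, j). A $$ (a + i, b + j))"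
proof -
  have rows: "{i. i < dim_row A \<and> i \<in> {a..<a + k}} = {a..<a + k}"
    and cols: "{j. j < dim_col A \<and> j \<in> {b..<b + l}} = {b..<b + l}"
    using assms by auto
  \<comment> \<open>\<open>submatrix_index_card\<close> locates an entry by counting the selected
    indices below it; in an interval this count is the offset.\<close>
  have below: "card {x \<in> {c..<c + m}. x < c + i} = i" if "i < m" for c m i :: nat
  proof -
    have "{x \<in> {c..<c + m}. x < c + i} = {c..<c + i}" using that by auto
    then show ?thesis by simp
  qed
  show ?thesis
  proof (rule eq_matI)
    fix i j assume "i < dim_row (Matrix.mat k l (\<lambda>(i, j). A $$ (a + i, b + j)))"
      "j < dim_col (Matrix.mat k l (\<lambda>(i, j). A $$ (a + i, b + j)))"
    then have ij: "i < k" "j < l" by auto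
    then show "submatrix A {a..<a + k} {b..<b + l} $$ (i, j) =
        Matrix.mat k l (\<lambda>(i, j). A $$ (a + i, b + j)) $$ (i, j)"
      using submatrix_index_card[of "a + i" A "b + j" "{a..<a + k}" "{b..<b + l}"] assms
      unfolding below[OF ij(1)] below[OF ij(2)] by simp
  qed (simp_all only: dim_submatrix rows cols, simp_all)
qed

lemma leading_minor_eq:
  assumes "A \<in> carrier_mat n n" "k \<le> n"
  shows "leading_minor k A = det (Matrix.mat k k (\<lambda>(i, j). A $$ (i, j)))"
  using submatrix_atLeastLessThan[of 0 k A 0 k] assms by (simp add: leading_minor_def)

lemma trailing_minor_eq:
  assumes "A \<in> carrier_mat n n" "k \<le> n"
  shows "trailing_minor n k A = det (Matrix.mat k k (\<lambda>(i, j). A $$ (n - k + i, n - k + j)))"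
  using submatrix_atLeastLessThan[of "n - k" k A "n - k" k] assms by (simp add: trailing_minor_def)

section \<open>Bijectivity of the map onto \<open>LPM n \<epsilon>\<close>\<close>

context
  fixes n :: nat and \<epsilon> :: "nat \<Rightarrow> real"
  assumes \<epsilon>: "sign_vector n \<epsilon>"
begin

private definition "d i = (if i = 0 then \<epsilon> 1 else \<epsilon> i * \<epsilon> (i + 1))"

private lemma sign_diag_eq: "sign_diag n \<epsilon> = mat_diag n d"
  by (simp add: sign_diag_def d_def[abs_def])

private lemma \<epsilon>_sgn: "k \<in> {1..n} \<Longrightarrow> \<epsilon> k \<in> {1, -1}"
  using \<epsilon> by (simp add: sign_vector_def)

private lemma d_sgn: "m < n \<Longrightarrow> d m \<in> {1, -1}"
  using \<epsilon>_sgn[of m] \<epsilon>_sgn[of "m + 1"] by (auto simp: d_def)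

text \<open>The product telescopes, as each intermediate sign occurs twice. This links the diagonal
  of \<open>sign_diag\<close> with the signs of the leading minors.\<close>

private lemma prod_d: "k \<in> {1..n} \<Longrightarrow> (\<Prod>m<k. d m) = \<epsilon> k"
proof (induction k)
  case (Suc k)
  then show ?case using \<epsilon>_sgn[of k] by (cases "k = 0") (auto simp: d_def)
qed simp

text \<open>A leading block of L D L^T is again of the form \<open>ldl\<close> with the same
  \<open>l\<close> and \<open>d\<close>, so \<open>det_ldl\<close> computes every leading
  minor.\<close>

lemma LPM_map_in_LPM:
  assumes "L \<in> pos_lower n"
  shows "LPM_map n \<epsilon> L \<in> LPM n \<epsilon>"
proof -
  have L: "L \<in> carrier_mat n n" and upper: "\<And>i j. i < j \<Longrightarrow> j < n \<Longrightarrow> L $$ (i, j) = 0"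
    and pos: "\<And>j. j < n \<Longrightarrow> L $$ (j, j) > 0"
    using assms by (auto simp: pos_lower_def)
  have eq: "LPM_map n \<epsilon> L = Matrix.mat n n (\<lambda>(i, j). ldl d (\<lambda>i j. L $$ (i, j)) i j)"
    unfolding LPM_map_def sign_diag_eq by (rule LDL_eq_mat_ldl[OF L upper])
  have "sgn (leading_minor k (LPM_map n \<epsilon> L)) = \<epsilon> k" if k: "k \<in> {1..n}" for k
  proof -
    have "leading_minor k (LPM_map n \<epsilon> L) =
        det (Matrix.mat k k (\<lambda>(i, j). ldl d (\<lambda>i j. L $$ (i, j)) i j))"
      using k by (subst leading_minor_eq[of _ n]) (auto simp: eq intro!: arg_cong[of _ _ det] cong_mat)
    then have "sgn (leading_minor k (LPM_map n \<epsilon> L)) = (\<Prod>m<k. sgn (d m * (L $$ (m, m))\<^sup>2))"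
      by (simp add: det_ldl sgn_prod_eq)
    also have "\<dots> = (\<Prod>m<k. d m)"
    proof (intro prod.cong refl)
      fix m assume "m \<in> {..<k}"
      then have "m < n" using k by simp
      then show "sgn (d m * (L $$ (m, m))\<^sup>2) = d m"
        using d_sgn[of m] pos[of m] by (intro sgn_mult_power2) auto
    qed
    finally show ?thesis using prod_d[OF k] by simp
  qed
  moreover from this have "leading_minor k (LPM_map n \<epsilon> L) \<noteq> 0" if "k \<in> {1..n}" for k
    using \<epsilon>_sgn[OF that] that by fastforce
  moreover have "transpose_mat (LPM_map n \<epsilon> L) = LPM_map n \<epsilon> L"
    unfolding eq by (rule eq_matI) (auto intro: ldl_commute)
  moreover have "LPM_map n \<epsilon> L \<in> carrier_mat n n" by (simp add: eq)
  ultimately show ?thesis by (simp add: LPM_def)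
qed

lemma bij_betw_LPM_map: "bij_betw (LPM_map n \<epsilon>) (pos_lower n) (LPM n \<epsilon>)"
  unfolding bij_betw_def
proof
  show "inj_on (LPM_map n \<epsilon>) (pos_lower n)"
  proof
    fix L K assume LK: "L \<in> pos_lower n" "K \<in> pos_lower n" "LPM_map n \<epsilon> L = LPM_map n \<epsilon> K"
    then have L: "L \<in> carrier_mat n n" "\<And>i j. i < j \<Longrightarrow> j < n \<Longrightarrow> L $$ (i, j) = 0"
      "\<And>j. j < n \<Longrightarrow> L $$ (j, j) > 0"
      and K: "K \<in> carrier_mat n n" "\<And>i j. i < j \<Longrightarrow> j < n \<Longrightarrow> K $$ (i, j) = 0"
      "\<And>j. j < n \<Longrightarrow> K $$ (j, j) > 0"
      by (auto simp: pos_lower_def)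
    have "ldl d (\<lambda>i j. L $$ (i, j)) i j = ldl d (\<lambda>i j. K $$ (i, j)) i j" if "i < n" "j < n" for i j
      using LK(3) index_LDL[OF L(1,2) that, of d] index_LDL[OF K(1,2) that, of d]
      by (simp add: LPM_map_def sign_diag_eq)
    then have lower: "L $$ (i, j) = K $$ (i, j)" if "j \<le> i" "i < n" for i j
      using that d_sgn L(3) K(3)
      by (intro ldl_unique[of n "\<lambda>i j. L $$ (i, j)" "\<lambda>i j. K $$ (i, j)" d]) fastforce+
    show "L = K"
    proof (rule eq_matI)
      fix i j assume "i < dim_row K" "j < dim_col K"
      then have "i < n" "j < n" using K(1) by auto
      then show "L $$ (i, j) = K $$ (i, j)"
        using lower[of j i] L(2)[of i j] K(2)[of i j] by (cases "j \<le> i") auto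
    qed (use L(1) K(1) in auto)
  qed
  show "LPM_map n \<epsilon> ` pos_lower n = LPM n \<epsilon>"
  proof
    show "LPM_map n \<epsilon> ` pos_lower n \<subseteq> LPM n \<epsilon>" using LPM_map_in_LPM by blast
    show "LPM n \<epsilon> \<subseteq> LPM_map n \<epsilon> ` pos_lower n"
    proof
      fix A assume "A \<in> LPM n \<epsilon>"
      then have A: "A \<in> carrier_mat n n" "transpose_mat A = A"
        "\<And>k. k \<in> {1..n} \<Longrightarrow> sgn (leading_minor k A) = \<epsilon> k"
        by (auto simp: LPM_def)
      have sym: "A $$ (i, j) = A $$ (j, i)" if "i < n" "j < n" for i j
        using arg_cong[OF A(2), of "\<lambda>B. B $$ (i, j)"] A(1) that by simp
      have sgn: "sgn (det (Matrix.mat k k (\<lambda>(i, j). A $$ (i, j)))) = (\<Prod>m<k. d m)" if "k \<in> {1..n}" for k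
        using A(3)[OF that] prod_d[OF that] leading_minor_eq[OF A(1), of k] that by simp
      obtain l where l: "\<And>i. i < n \<Longrightarrow> l i i > 0"
          "\<And>i j. i < n \<Longrightarrow> j < n \<Longrightarrow> A $$ (i, j) = ldl d l i j"
        using ldl_exists[of n "\<lambda>i j. A $$ (i, j)" d, OF sym sgn d_sgn] by blast
      \<comment> \<open>\<open>ldl_exists\<close> says nothing about \<open>l\<close> above the
        diagonal, so these values are replaced by 0.\<close>
      define L where "L = Matrix.mat n n (\<lambda>(i, j). if j \<le> i then l i j else 0)"
      have L: "L \<in> pos_lower n" using l(1) by (auto simp: L_def pos_lower_def)
      then have "LPM_map n \<epsilon> L = Matrix.mat n n (\<lambda>(i, j). ldl d (\<lambda>i j. L $$ (i, j)) i j)"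
        unfolding LPM_map_def sign_diag_eq by (intro LDL_eq_mat_ldl) (auto simp: pos_lower_def)
      also have "\<dots> = A"
        by (rule eq_matI) (use A(1) l(2) in \<open>auto simp: L_def intro!: ldl_cong\<close>)
      finally show "A \<in> LPM_map n \<epsilon> ` pos_lower n" using L by blast
    qed
  qed
qed

end

subsection \<open>Reversal of rows and columns\<close>

text \<open>Conjugation by the anti-diagonal permutation (see \<open>antidiag_perm_conj\<close>),
  given by entries. With indices from 0, position \<open>i\<close> is mirrored to
  \<open>n - Suc i\<close>.\<close>

definition flip_mat :: "nat \<Rightarrow> real mat \<Rightarrow> real mat" where
  "flip_mat n A = Matrix.mat n n (\<lambda>(i, j). A $$ (n - Suc i, n - Suc j))"

lemma flip_mat_carrier [simp]: "flip_mat n A \<in> carrier_mat n n"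
  by (simp add: flip_mat_def)

lemma index_flip_mat [simp]:
  "i < n \<Longrightarrow> j < n \<Longrightarrow> flip_mat n A $$ (i, j) = A $$ (n - Suc i, n - Suc j)"
  by (simp add: flip_mat_def)

lemma flip_mat_flip_mat: "A \<in> carrier_mat n n \<Longrightarrow> flip_mat n (flip_mat n A) = A"
  by (rule eq_matI) (auto simp: flip_mat_def Suc_diff_Suc)

lemma flip_mat_transpose:
  "A \<in> carrier_mat n n \<Longrightarrow> flip_mat n (transpose_mat A) = transpose_mat (flip_mat n A)"
  by (rule eq_matI) (auto simp: flip_mat_def)

lemma flip_mat_mult:
  assumes "A \<in> carrier_mat n n" "B \<in> carrier_mat n n"
  shows "flip_mat n (A * B) = flip_mat n A * flip_mat n B"
proof (rule eq_matI)
  fix i j assume "i < dim_row (flip_mat n A * flip_mat n B)" "j < dim_col (flip_mat n A * flip_mat n B)"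
  then have ij: "i < n" "j < n" by (auto simp: flip_mat_def)
  have "(\<Sum>m<n. A $$ (n - Suc i, m) * B $$ (m, n - Suc j)) =
      (\<Sum>m<n. A $$ (n - Suc i, n - Suc m) * B $$ (n - Suc m, n - Suc j))"
    by (rule sum.nat_diff_reindex[symmetric])
  then show "flip_mat n (A * B) $$ (i, j) = (flip_mat n A * flip_mat n B) $$ (i, j)"
    using ij assms by (simp add: scalar_prod_def atLeast0LessThan flip_mat_def)
qed (simp_all add: flip_mat_def)

lemma index_antidiag_perm_mult:
  assumes "A \<in> carrier_mat n n" "i < n" "j < n"
  shows "(antidiag_perm n * A) $$ (i, j) = A $$ (n - Suc i, j)"
proof -
  have iff: "i + x + 1 = n \<longleftrightarrow> x = n - Suc i" for x using assms by auto
  have "(antidiag_perm n * A) $$ (i, j) = (\<Sum>x<n. (if i + x + 1 = n then 1 else 0) * A $$ (x, j))"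
    using assms by (simp add: antidiag_perm_def scalar_prod_def atLeast0LessThan)
  then show ?thesis using assms by (simp only: iff mult_delta_left) simp
qed

lemma index_mult_antidiag_perm:
  assumes "A \<in> carrier_mat n n" "i < n" "j < n"
  shows "(A * antidiag_perm n) $$ (i, j) = A $$ (i, n - Suc j)"
proof -
  have iff: "x + j + 1 = n \<longleftrightarrow> x = n - Suc j" for x using assms by auto
  have "(A * antidiag_perm n) $$ (i, j) = (\<Sum>x<n. A $$ (i, x) * (if x + j + 1 = n then 1 else 0))"
    using assms by (simp add: antidiag_perm_def scalar_prod_def atLeast0LessThan)
  then show ?thesis using assms by (simp only: iff mult_delta_right) simp
qed

lemma antidiag_perm_conj:
  assumes A: "A \<in> carrier_mat n n"
  shows "antidiag_perm n * A * antidiag_perm n = flip_mat n A"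
proof (rule eq_matI)
  have PA: "antidiag_perm n * A \<in> carrier_mat n n"
    using A by (auto simp: antidiag_perm_def)
  fix i j assume "i < dim_row (flip_mat n A)" "j < dim_col (flip_mat n A)"
  then have "i < n" "j < n" by (auto simp: flip_mat_def)
  then show "(antidiag_perm n * A * antidiag_perm n) $$ (i, j) = flip_mat n A $$ (i, j)"
    by (simp only: index_mult_antidiag_perm[OF PA] index_flip_mat)
      (intro index_antidiag_perm_mult[OF A], simp_all)
qed (use A in \<open>simp_all add: antidiag_perm_def flip_mat_def\<close>)

text \<open>The anti-diagonal permutation is an involution, so its determinant squares to 1 and its
  sign never has to be found.\<close>

lemma det_flip_mat:
  assumes "A \<in> carrier_mat n n"
  shows "det (flip_mat n A) = det A"
proof -
  have P: "antidiag_perm n \<in> carrier_mat n n" by (simp add: antidiag_perm_def)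
  have "antidiag_perm n * antidiag_perm n = flip_mat n (1\<^sub>m n)"
    using antidiag_perm_conj[of "1\<^sub>m n" n] P by simp
  also have "\<dots> = 1\<^sub>m n" by (rule eq_matI) (auto simp: flip_mat_def)
  finally have "det (antidiag_perm n) * det (antidiag_perm n) = 1"
    using det_mult[OF P P] by simp
  moreover have "det (flip_mat n A) = det (antidiag_perm n) * det A * det (antidiag_perm n)"
    unfolding antidiag_perm_conj[OF assms, symmetric]
    using P assms by (simp add: det_mult[of _ n])
  ultimately show ?thesis by (simp add: mult_ac)
qed

lemma trailing_minor_flip_mat:
  assumes "A \<in> carrier_mat n n" "k \<le> n"
  shows "trailing_minor n k (flip_mat n A) = leading_minor k A"
proof -
  \<comment> \<open>A trailing block of the flipped matrix is the flipped leading block: mirroring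
    \<open>n - k + i\<close> in order \<open>n\<close> gives \<open>k - Suc i\<close>, the mirror of
    \<open>i\<close> in order \<open>k\<close>.\<close>
  have "Matrix.mat k k (\<lambda>(i, j). flip_mat n A $$ (n - k + i, n - k + j)) =
      flip_mat k (Matrix.mat k k (\<lambda>(i, j). A $$ (i, j)))"
    by (rule eq_matI) (use assms in \<open>auto simp: flip_mat_def\<close>)
  then show ?thesis
    using assms by (simp add: trailing_minor_eq leading_minor_eq det_flip_mat)
qed

lemma leading_minor_flip_mat:
  assumes "A \<in> carrier_mat n n" "k \<le> n"
  shows "leading_minor k (flip_mat n A) = trailing_minor n k A"
  using trailing_minor_flip_mat[of "flip_mat n A" n k] assms by (simp add: flip_mat_flip_mat)

lemma bij_betw_flip_mat_LPM: "bij_betw (flip_mat n) (LPM n \<epsilon>) (TPM n \<epsilon>)"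
proof (rule bij_betw_byWitness[where f' = "flip_mat n"])
  show "flip_mat n ` LPM n \<epsilon> \<subseteq> TPM n \<epsilon>"
    by (auto simp: LPM_def TPM_def trailing_minor_flip_mat flip_mat_transpose[symmetric])
  show "flip_mat n ` TPM n \<epsilon> \<subseteq> LPM n \<epsilon>"
    by (auto simp: LPM_def TPM_def leading_minor_flip_mat flip_mat_transpose[symmetric])
qed (auto simp: LPM_def TPM_def flip_mat_flip_mat)

text \<open>Reversal makes a lower triangular matrix upper triangular and transposition undoes this;
  since the two commute, the composite is an involution.\<close>

lemma bij_betw_flip_transpose_pos_lower:
  "bij_betw (\<lambda>L. flip_mat n (transpose_mat L)) (pos_lower n) (pos_lower n)"
proof -
  have "flip_mat n (transpose_mat L) \<in> pos_lower n" if "L \<in> pos_lower n" for L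
    using that by (auto simp: pos_lower_def)
  then show ?thesis
    by (intro bij_betw_byWitness[where f' = "\<lambda>L. flip_mat n (transpose_mat L)"])
      (auto simp: pos_lower_def flip_mat_transpose flip_mat_flip_mat)
qed

text \<open>Reversal is multiplicative and commutes with transposition. Applied to K D K^T with K
  the flip of L^T, it returns L^T and L as outer factors and the conjugate of D in the
  middle.\<close>

lemma TPM_map_eq_flip_mat:
  assumes "L \<in> carrier_mat n n"
  shows "TPM_map n \<epsilon> L = flip_mat n (LPM_map n \<epsilon> (flip_mat n (transpose_mat L)))"
proof -
  have D: "sign_diag n \<epsilon> \<in> carrier_mat n n" by (simp add: sign_diag_def)
  show ?thesis
    using assms D
    by (simp add: TPM_map_def LPM_map_def antidiag_perm_conj flip_mat_mult[of _ n]
        flip_mat_transpose flip_mat_flip_mat transpose_carrier_mat mult_carrier_mat[of _ n n])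
qed

lemma bij_betw_TPM_map:
  assumes "sign_vector n \<epsilon>"
  shows "bij_betw (TPM_map n \<epsilon>) (pos_lower n) (TPM n \<epsilon>)"
proof -
  have "bij_betw (flip_mat n \<circ> (LPM_map n \<epsilon> \<circ> (\<lambda>L. flip_mat n (transpose_mat L))))
      (pos_lower n) (TPM n \<epsilon>)"
    by (rule bij_betw_trans[OF bij_betw_trans[OF bij_betw_flip_transpose_pos_lower
          bij_betw_LPM_map[OF assms]] bij_betw_flip_mat_LPM])
  then show ?thesis
    by (rule iffD1[OF bij_betw_cong, rotated]) (simp add: pos_lower_def TPM_map_eq_flip_mat)
qed

subsection \<open>Euclidean coordinates of triangular matrices\<close>

lemma index_L_mult:
  assumes "i < n" "j < n"
  shows "(L \<otimes>\<^bsub>L_group n\<^esub> K) $$ (i, j) =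
    (if i = j then L $$ (i, i) * K $$ (i, i) else if j < i then L $$ (i, j) + K $$ (i, j) else 0)"
  using assms
  by (simp add: L_group_def strict_lower_part_def diag_part_def) (simp add: mat_diag_def)

lemma L_mult_closed:
  assumes "L \<in> pos_lower n" "K \<in> pos_lower n"
  shows "L \<otimes>\<^bsub>L_group n\<^esub> K \<in> pos_lower n"
proof -
  have "L \<otimes>\<^bsub>L_group n\<^esub> K \<in> carrier_mat n n"
    by (intro carrier_matI) (simp_all add: L_group_def diag_part_def mat_diag_def)
  then show ?thesis using assms by (auto simp: pos_lower_def index_L_mult)
qed

lemma L_dist_nonneg: "0 \<le> L_dist n L K"
  by (simp add: L_dist_def sum_nonneg)

lemma L_dist_commute: "L_dist n L K = L_dist n K L"
  by (simp add: L_dist_def power2_commute)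

definition L_coord :: "real mat \<Rightarrow> nat \<times> nat \<Rightarrow> real" where
  "L_coord L p = (if fst p = snd p then ln (L $$ p) else L $$ p)"

text \<open>\<open>h\<close> lists the positions on and below the diagonal in an arbitrary order;
  group law and distance treat these coordinates independently, so no particular order is
  required.\<close>

context
  fixes n m :: nat and h :: "nat \<Rightarrow> nat \<times> nat"
  assumes h: "bij_betw h {..<m} (SIGMA i:{..<n}. {..i})"
begin

private lemma h_less: "p < m \<Longrightarrow> \<exists>i j. h p = (i, j) \<and> j \<le> i \<and> i < n"
  using bij_betwE[OF h] by fastforce

private definition "\<phi> L = Matrix.vec m (\<lambda>p. L_coord L (h p))"

private lemma \<phi>_mult:
  assumes "L \<in> pos_lower n" "K \<in> pos_lower n"
  shows "\<phi> (L \<otimes>\<^bsub>L_group n\<^esub> K) = \<phi> L + \<phi> K"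
proof (rule eq_vecI)
  fix p assume "p < dim_vec (\<phi> L + \<phi> K)"
  then have p: "p < m" by (simp add: \<phi>_def)
  then obtain i j where ij: "h p = (i, j)" "j \<le> i" "i < n" using h_less by blast
  then have "L $$ (i, i) > 0" "K $$ (i, i) > 0" using assms by (auto simp: pos_lower_def)
  with p ij show "vec_index (\<phi> (L \<otimes>\<^bsub>L_group n\<^esub> K)) p = vec_index (\<phi> L + \<phi> K) p"
    by (auto simp: \<phi>_def L_coord_def index_L_mult ln_mult)
qed (simp add: \<phi>_def)

private lemma \<phi>_one: "\<phi> (1\<^sub>m n) = 0\<^sub>v m"
proof (rule eq_vecI)
  fix p assume "p < dim_vec (0\<^sub>v m :: real vec)"
  then have p: "p < m" by simp
  then obtain i j where ij: "h p = (i, j)" "j \<le> i" "i < n" using h_less by blast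
  with p show "vec_index (\<phi> (1\<^sub>m n)) p = vec_index (0\<^sub>v m) p"
    by (auto simp: \<phi>_def L_coord_def)
qed (simp add: \<phi>_def)

text \<open>Both sides apply the same total \<open>ln\<close> to the diagonal, so membership in
  \<open>pos_lower n\<close> is not assumed; the sums differ only by reindexing along
  \<open>h\<close>.\<close>

private lemma \<phi>_dist: "euclidean_vec_dist m (\<phi> L) (\<phi> K) = L_dist n L K"
proof -
  have "(\<Sum>p<m. (L_coord L (h p) - L_coord K (h p))\<^sup>2) =
      (\<Sum>p\<in>(SIGMA i:{..<n}. {..i}). (L_coord L p - L_coord K p)\<^sup>2)"
    by (rule sum.reindex_bij_betw[OF h])
  also have "\<dots> = (\<Sum>i<n. \<Sum>j<i. (L $$ (i, j) - K $$ (i, j))\<^sup>2) +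
      (\<Sum>j<n. (ln (L $$ (j, j)) - ln (K $$ (j, j)))\<^sup>2)"
    by (simp add: sum_lower_triangle L_coord_def)
  finally show ?thesis by (simp add: euclidean_vec_dist_def L2_set_def \<phi>_def L_dist_def)
qed

private lemma \<phi>_bij: "bij_betw \<phi> (pos_lower n) (carrier_vec m)"
  unfolding bij_betw_def
proof
  show "inj_on \<phi> (pos_lower n)"
  proof
    fix L K assume LK: "L \<in> pos_lower n" "K \<in> pos_lower n" and eq: "\<phi> L = \<phi> K"
    show "L = K"
    proof (rule eq_matI)
      fix i j assume "i < dim_row K" "j < dim_col K"
      then have ij: "i < n" "j < n" using LK by (auto simp: pos_lower_def)
      show "L $$ (i, j) = K $$ (i, j)"
      proof (cases "j \<le> i")
        case True
        then have "(i, j) \<in> h ` {..<m}" using h ij by (auto simp: bij_betw_def)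
        then obtain p where "p < m" "h p = (i, j)" by auto
        then have "L_coord L (i, j) = L_coord K (i, j)"
          using arg_cong[OF eq, of "\<lambda>v. vec_index v p"] by (simp add: \<phi>_def)
        then show ?thesis using LK ij by (auto simp: L_coord_def pos_lower_def split: if_splits)
      next
        case False
        then show ?thesis using LK ij by (auto simp: pos_lower_def)
      qed
    qed (use LK in \<open>auto simp: pos_lower_def\<close>)
  qed
  have "v \<in> \<phi> ` pos_lower n" if v: "v \<in> carrier_vec m" for v
  proof
    \<comment> \<open>The preimage reads each entry of \<open>v\<close> at its position under
      \<open>h\<close> and exponentiates on the diagonal, which makes the diagonal positive.\<close>
    define x where "x i j = vec_index v (inv_into {..<m} h (i, j))" for i j
    define L where "L = Matrix.mat n n (\<lambda>(i, j). if i < j then 0 else if i = j then exp (x i j) else x i j)"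
    show "L \<in> pos_lower n" by (auto simp: L_def pos_lower_def)
    show "v = \<phi> L"
    proof (rule eq_vecI)
      fix p assume "p < dim_vec (\<phi> L)"
      then have p: "p < m" by (simp add: \<phi>_def)
      then obtain i j where ij: "h p = (i, j)" "j \<le> i" "i < n" using h_less by blast
      then have "vec_index v p = x i j"
        using bij_betw_inv_into_left[OF h, of p] p by (simp add: x_def)
      then show "vec_index v p = vec_index (\<phi> L) p"
        using p ij by (cases "i = j") (simp_all add: \<phi>_def L_coord_def L_def)
    qed (use v in \<open>simp add: \<phi>_def\<close>)
  qed
  then show "\<phi> ` pos_lower n = carrier_vec m" by (auto simp: \<phi>_def)
qed

lemma L_coordinates:
  obtains f where "bij_betw f (carrier (L_group n)) (carrier_vec m)"
    and "\<And>L K. L \<in> carrier (L_group n) \<Longrightarrow> K \<in> carrier (L_group n) \<Longrightarrow>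
      f (L \<otimes>\<^bsub>L_group n\<^esub> K) = f L + f K"
    and "f \<one>\<^bsub>L_group n\<^esub> = 0\<^sub>v m"
    and "\<And>L K. euclidean_vec_dist m (f L) (f K) = L_dist n L K"
proof
  show "bij_betw \<phi> (carrier (L_group n)) (carrier_vec m)"
    using \<phi>_bij by (simp add: L_group_def)
  show "\<phi> (L \<otimes>\<^bsub>L_group n\<^esub> K) = \<phi> L + \<phi> K"
    if "L \<in> carrier (L_group n)" "K \<in> carrier (L_group n)" for L K
    using \<phi>_mult that by (simp add: L_group_def)
  show "\<phi> \<one>\<^bsub>L_group n\<^esub> = 0\<^sub>v m" using \<phi>_one by (simp add: L_group_def)
qed (rule \<phi>_dist)

end

theorem theorem3:
  fixes n :: nat and \<epsilon> :: "nat \<Rightarrow> real"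
  assumes "n \<ge> 1" and "sign_vector n \<epsilon>"
  shows "\<forall>(G, d) \<in> {(L_group n, L_dist n), (LPM_group n \<epsilon>, LPM_dist n \<epsilon>), (TPM_group n \<epsilon>, TPM_dist n \<epsilon>)}.
    abelian_metric_group G d \<and>
    isometrically_isomorphic G d
      (monoid_vec TYPE(real) (n * (n + 1) div 2)) (euclidean_vec_dist (n * (n + 1) div 2)) \<and>
    separable_metric G d \<and>
    complete_metric G d"
proof -
  let ?m = "n * (n + 1) div 2"
  have "card (SIGMA i:{..<n}. {..i}) = (\<Sum>i<n. Suc i)" by simp
  also have "\<dots> = ?m" by (induction n) auto
  finally obtain h where h: "bij_betw h {..<?m} (SIGMA i:{..<n}. {..i})"
    using ex_bij_betw_nat_finite[of "SIGMA i:{..<n}. {..i}"] by (auto simp: atLeast0LessThan)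
  obtain f where f: "bij_betw f (carrier (L_group n)) (carrier_vec ?m)"
    "\<And>L K. L \<in> carrier (L_group n) \<Longrightarrow> K \<in> carrier (L_group n) \<Longrightarrow>
      f (L \<otimes>\<^bsub>L_group n\<^esub> K) = f L + f K"
    "f \<one>\<^bsub>L_group n\<^esub> = 0\<^sub>v ?m"
    "\<And>L K. euclidean_vec_dist ?m (f L) (f K) = L_dist n L K"
    using L_coordinates[OF h] by blast
  have carrier: "carrier (L_group n) = pos_lower n" by (simp add: L_group_def)
  have closed: "L \<otimes>\<^bsub>L_group n\<^esub> K \<in> carrier (L_group n)"
    if "L \<in> carrier (L_group n)" "K \<in> carrier (L_group n)" for L K
    using L_mult_closed that by (simp add: carrier)
  have one: "\<one>\<^bsub>L_group n\<^esub> \<in> carrier (L_group n)"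
    by (auto simp: L_group_def pos_lower_def)
  \<comment> \<open>The hole is the bijection onto the target set, filled below once for
    \<open>LPM\<close> and once for \<open>TPM\<close>; unfolding the carrier matches the
    definitions of the two distances.\<close>
  note transport = isometric_euclidean_transport[OF f(1) _ closed f(2) one f(3) f(4)
      L_dist_nonneg L_dist_commute, unfolded carrier]
  show ?thesis
    using isometric_euclidean_group[OF f(1) closed f(2) one f(3) f(4) L_dist_nonneg L_dist_commute]
      transport[OF bij_betw_LPM_map[OF assms(2)]] transport[OF bij_betw_TPM_map[OF assms(2)]]
    by (simp add: LPM_group_def LPM_dist_def TPM_group_def TPM_dist_def)
qed

end
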